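(* For every integer $n \geq 1$ and every partition $\lambda$ of $n$, $$\sum_{u \in \lambda} h(u) \geq n + \sum_{u \in \lambda} |c(u)|,$$ with equality if and only if $\lambda$ is a hook.
   Context: A partition $\lambda$ of $n$ is a weakly decreasing sequence of non-negative integers $\lambda_1 \geq \lambda_2 \geq \cdots$ with sum $n$, identified with its Young diagram: the set of cells $(i,j)$ with $i \ge 1$, $1 \le j \le \lambda_i$. For a cell $u=(i,j) \in \lambda$, the hook $H(u)$ is the set of cells $(k,l) \in \lambda$ such that either $k=i$ and $l \geq j$, or $l=j$ and $k \geq i$; the hook length is $h(u) = |H(u)|$, and the content is $c(u)=j-i$. The partition $\lambda$ is called a hook if its set of cells equals $H((1,1))$. *)

theory Defs
  imports Main
begin

text \<open>Parts are indexed from 1, so the value at index 0 is irrelevant and is ignored by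
  every definition below.\<close>

definition is_partition :: "nat \<Rightarrow> (nat \<Rightarrow> nat) \<Rightarrow> bool" where
  "is_partition n lam \<longleftrightarrow>
     antimono_on {1..} lam \<and>
     finite {i. 1 \<le> i \<and> lam i \<noteq> 0} \<and>
     (\<Sum>i | 1 \<le> i \<and> lam i \<noteq> 0. lam i) = n"

definition cells :: "(nat \<Rightarrow> nat) \<Rightarrow> (nat \<times> nat) set" where
  "cells lam = {(i, j). 1 \<le> i \<and> 1 \<le> j \<and> j \<le> lam i}"

definition hook :: "(nat \<Rightarrow> nat) \<Rightarrow> nat \<times> nat \<Rightarrow> (nat \<times> nat) set" where
  "hook lam = (\<lambda>(i, j). {(k, l) \<in> cells lam. (k = i \<and> j \<le> l) \<or> (l = j \<and> i \<le> k)})"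

definition hook_length :: "(nat \<Rightarrow> nat) \<Rightarrow> nat \<times> nat \<Rightarrow> nat" where
  "hook_length lam u = card (hook lam u)"

definition content :: "nat \<times> nat \<Rightarrow> int" where
  "content = (\<lambda>(i, j). int j - int i)"

definition is_hook :: "(nat \<Rightarrow> nat) \<Rightarrow> bool" where
  "is_hook lam \<longleftrightarrow> cells lam = hook lam (1, 1)"

end

theory Submission
  imports Defs
begin

text \<open>
  The sum of the hook lengths counts the pairs \<open>(u, v)\<close> of cells with \<open>v\<close> in the hook of
  \<open>u\<close>. For fixed \<open>v = (i, j)\<close> the cells \<open>u\<close> whose hook contains \<open>v\<close> are those weakly above \<open>v\<close>
  in its column and weakly to its left in its row. All these positions belong to the diagram, so
  there are \<open>i + j - 1\<close> of them, whatever the partition: this is \<open>hook_length_sum\<close>. On the other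
  side, each cell contributes \<open>1 + \<bar>j - i\<bar>\<close>, as a partition of \<open>n\<close> has \<open>n\<close> cells. Since
  \<open>i + j = \<bar>j - i\<bar> + 2 * min i j\<close>, the two sides of the inequality differ by the sum of
  the non-negative numbers \<open>2 * (min i j - 1)\<close> over all cells. This sum vanishes exactly when every
  cell lies in the first row or the first column, that is, in the hook of the corner cell.
\<close>

lemma cells_eq_Sigma: "cells lam = Sigma {i. 1 \<le> i \<and> lam i \<noteq> 0} (\<lambda>i. {1..lam i})"
  by (auto simp: cells_def)

lemma finite_cells:
  assumes "is_partition n lam"
  shows "finite (cells lam)"
  using assms unfolding is_partition_def cells_eq_Sigma by (intro finite_SigmaI) auto

lemma card_cells:
  assumes "is_partition n lam"
  shows "card (cells lam) = n"
  using assms unfolding is_partition_def cells_eq_Sigma by (subst card_SigmaI) auto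

lemma mem_cells_mono:
  assumes "is_partition n lam" "(k, l) \<in> cells lam" "1 \<le> i" "i \<le> k" "1 \<le> j" "j \<le> l"
  shows "(i, j) \<in> cells lam"
proof -
  have "lam k \<le> lam i"
    using assms by (auto simp: is_partition_def monotone_on_def)
  then show ?thesis
    using assms by (auto simp: cells_def)
qed

lemma card_cells_with_hook_through:
  assumes "is_partition n lam" "(k, l) \<in> cells lam"
  shows "int (card {u \<in> cells lam. (k, l) \<in> hook lam u}) = int k + int l - 1"
proof -
  \<comment> \<open>The row piece leaves out \<open>(k, l)\<close> itself, so that the pieces are disjoint and their sizes add.\<close>
  have "{u \<in> cells lam. (k, l) \<in> hook lam u} = {1..k} \<times> {l} \<union> {k} \<times> {1..<l}" (is "?L = ?R")
  proof
    show "?L \<subseteq> ?R"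
      by (auto simp: hook_def cells_def)
    have "1 \<le> k" "1 \<le> l"
      using assms(2) by (auto simp: cells_def)
    then show "?R \<subseteq> ?L"
      using assms(2) mem_cells_mono[OF assms] by (auto simp: hook_def)
  qed
  moreover have "card ({1..k} \<times> {l} \<union> {k} \<times> {1..<l}) = k + (l - 1)"
    by (subst card_Un_disjoint) (auto simp: card_cartesian_product)
  moreover have "1 \<le> l"
    using assms(2) by (auto simp: cells_def)
  ultimately show ?thesis
    by simp
qed

lemma hook_length_sum:
  assumes "is_partition n lam"
  shows "(\<Sum>u\<in>cells lam. int (hook_length lam u)) = (\<Sum>(i, j)\<in>cells lam. int i + int j - 1)"
proof -
  note fin = finite_cells[OF assms]
  have hook_subset: "hook lam u = {v \<in> cells lam. v \<in> hook lam u}" for u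
    by (auto simp: hook_def)
  have "(\<Sum>u\<in>cells lam. int (hook_length lam u))
      = (\<Sum>u\<in>cells lam. \<Sum>v | v \<in> cells lam \<and> v \<in> hook lam u. 1)"
    unfolding hook_length_def using hook_subset by simp
  also have "\<dots> = (\<Sum>v\<in>cells lam. \<Sum>u | u \<in> cells lam \<and> v \<in> hook lam u. 1)"
    by (rule sum.swap_restrict[OF fin fin])
  also have "\<dots> = (\<Sum>(i, j)\<in>cells lam. int i + int j - 1)"
    using card_cells_with_hook_through[OF assms] by (intro sum.cong) auto
  finally show ?thesis .
qed

lemma hook_length_sum_eq_content_sum:
  assumes "is_partition n lam"
  shows "(\<Sum>u\<in>cells lam. int (hook_length lam u))
    = int n + (\<Sum>u\<in>cells lam. \<bar>content u\<bar>) + (\<Sum>(i, j)\<in>cells lam. 2 * (int (min i j) - 1))"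
proof -
  have "(\<Sum>u\<in>cells lam. int (hook_length lam u))
      = (\<Sum>u\<in>cells lam. 1 + \<bar>content u\<bar> + (case u of (i, j) \<Rightarrow> 2 * (int (min i j) - 1)))"
    unfolding hook_length_sum[OF assms] by (intro sum.cong) (auto simp: content_def)
  then show ?thesis
    by (simp add: sum.distrib card_cells[OF assms])
qed

lemma is_hook_iff: "is_hook lam \<longleftrightarrow> (\<forall>(i, j)\<in>cells lam. min i j = 1)"
proof -
  have "min i j = 1 \<longleftrightarrow> i = 1 \<or> j = 1" if "(i, j) \<in> cells lam" for i j
    using that by (auto simp: cells_def min_def)
  moreover have "is_hook lam \<longleftrightarrow> (\<forall>(i, j)\<in>cells lam. i = 1 \<or> j = 1)"
    by (auto simp: is_hook_def hook_def cells_def)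
  ultimately show ?thesis
    by blast
qed

theorem proposition4p2:
  fixes n :: nat and lam :: "nat \<Rightarrow> nat"
  assumes "n \<ge> 1" and "is_partition n lam"
  shows "(\<Sum>u\<in>cells lam. int (hook_length lam u)) \<ge> int n + (\<Sum>u\<in>cells lam. \<bar>content u\<bar>) \<and>
    ((\<Sum>u\<in>cells lam. int (hook_length lam u)) = int n + (\<Sum>u\<in>cells lam. \<bar>content u\<bar>)
      \<longleftrightarrow> is_hook lam)"
proof -
  let ?excess = "\<lambda>(i, j). 2 * (int (min i j) - 1)"
  have nonneg: "0 \<le> ?excess u" if "u \<in> cells lam" for u
    using that by (auto simp: cells_def)
  have "sum ?excess (cells lam) = 0 \<longleftrightarrow> (\<forall>u\<in>cells lam. ?excess u = 0)"
    by (rule sum_nonneg_eq_0_iff[OF finite_cells[OF assms(2)] nonneg])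
  also have "\<dots> \<longleftrightarrow> is_hook lam"
    unfolding is_hook_iff by (intro ball_cong) auto
  finally have "sum ?excess (cells lam) = 0 \<longleftrightarrow> is_hook lam" .
  moreover have "0 \<le> sum ?excess (cells lam)"
    by (rule sum_nonneg[OF nonneg])
  ultimately show ?thesis
    unfolding hook_length_sum_eq_content_sum[OF assms(2)] by linarith
qed

end
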